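(* Let $\nu_0=0.83917\ldots$ be the positive real root of the equation $2(2\nu+1)e^{-2\nu}=1$. Then for every $f(z)=z+a_2z^2+a_3z^3+\cdots$ in the class $\mathcal{S}^+$ and every real $\gamma$ with $0\le\gamma<1$, $$-1\leq a_{3}-\gamma a_{2}^{2}\leq \begin{cases} 1+2e^{-2\gamma/(1-\gamma)}, & 0\leq \gamma \leq \frac{\nu_{0}}{1+\nu_{0}}=0.456278\ldots, \\[4pt] 2(1-\gamma)\dfrac{(\nu_{0}+1)^{2}}{2\nu_{0}+1}, & \frac{\nu_{0}}{1+\nu_{0}}\leq\gamma < 1.\end{cases}$$ The lower bound $-1$ is sharp: equality is attained by the function $f_1(z)=\frac{z}{1+z^2}$.
   Context: Let $\mathbb{D}=\{z\in\mathbb{C}:|z|<1\}$, and let $\mathcal{A}$ be the class of functions $f$ analytic in $\mathbb{D}$ of the form $f(z)=z+a_2z^2+a_3z^3+\cdots$. The class $\mathcal{S}^+$ consists of those $f\in\mathcal{A}$ that are univalent (injective) in $\mathbb{D}$ and for which $\frac{z}{f(z)}=1+b_1z+b_2z^2+\cdots$ in $\mathbb{D}$ with $b_n$ real and $b_n\ge 0$ for all $n\ge 1$. *)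

theory Defs
  imports "HOL-Complex_Analysis.Complex_Analysis"
begin

abbreviation unit_disc :: "complex set" ("\<D>")
  where "\<D> \<equiv> ball 0 1"

definition taylor_coeff :: "(complex \<Rightarrow> complex) \<Rightarrow> nat \<Rightarrow> complex"
  where "taylor_coeff f n = fps_nth (fps_expansion f 0) n"

definition class_A :: "(complex \<Rightarrow> complex) set"
  where "class_A = {f. f analytic_on \<D> \<and> taylor_coeff f 0 = 0 \<and> taylor_coeff f 1 = 1}"

text \<open>
  In Isabelle/HOL, \<open>z / f z\<close> evaluates to \<open>0\<close> at \<open>z = 0\<close>, whereas the removable
  singularity there has value \<open>1\<close>. So the expansion \<open>z / f z = 1 + b\<^sub>1 z + b\<^sub>2 z^2 + \<dots>\<close> is
  required on the punctured disc, and its value at the origin is imposed by \<open>b 0 = 1\<close>.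
  Off the origin the denominator is nonzero by injectivity.
\<close>

definition class_S_plus :: "(complex \<Rightarrow> complex) set"
  where "class_S_plus = {f \<in> class_A. inj_on f \<D> \<and>
    (\<exists>b :: nat \<Rightarrow> real. b 0 = 1 \<and> (\<forall>n\<ge>1. 0 \<le> b n) \<and>
      (\<forall>z\<in>\<D> - {0}. (\<lambda>n. of_real (b n) * z ^ n) sums (z / f z)))}"

definition fekete_szego :: "real \<Rightarrow> (complex \<Rightarrow> complex) \<Rightarrow> complex"
  where "fekete_szego \<gamma> f = taylor_coeff f 3 - of_real \<gamma> * (taylor_coeff f 2)\<^sup>2"

definition is_nu_root :: "real \<Rightarrow> bool"
  where "is_nu_root \<nu> \<longleftrightarrow> 0 < \<nu> \<and> 2 * (2 * \<nu> + 1) * exp (- 2 * \<nu>) = 1"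

definition nu0 :: real
  where "nu0 = (THE \<nu>. is_nu_root \<nu>)"

end

theory Submission
  imports Defs
begin

text \<open>
  Comparing coefficients in \<open>f z * (z / f z) = z\<close> gives \<open>a\<^sub>2 = - b\<^sub>1\<close> and
  \<open>a\<^sub>3 = b\<^sub>1\<^sup>2 - b\<^sub>2\<close>, so the functional is \<open>(1 - \<gamma>) b\<^sub>1\<^sup>2 - b\<^sub>2\<close>, and everything comes down to
  the region of possible pairs \<open>(b\<^sub>1, b\<^sub>2)\<close>. Because the \<open>b\<^sub>n\<close> are real and nonnegative, this region
  can be bounded by looking at \<open>f\<close> on the real diameter alone.

  On \<open>(-1, 1)\<close> the function is real, continuous and injective, hence strictly monotone, and it is
  positive to the right of \<open>0\<close>; so it increases and is negative to the left of \<open>0\<close>. Its growth on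
  \<open>(0, 1)\<close> says that \<open>1 / f x = 1 / x + b\<^sub>1 + b\<^sub>2 x + b\<^sub>3 x\<^sup>2 + \<dots>\<close> decreases, and letting \<open>x\<close> tend to
  \<open>1\<close> this becomes \<open>\<Sum> (n - 1) b\<^sub>n \<le> 1\<close>, the sum over \<open>n \<ge> 2\<close>. In particular \<open>b\<^sub>2 \<le> 1\<close>, which
  gives the lower bound \<open>-1\<close>. Its sign on \<open>(-1, 0)\<close> says that \<open>1 - b\<^sub>1 r + b\<^sub>2 r\<^sup>2 - b\<^sub>3 r\<^sup>3 + \<dots>\<close>
  is nonnegative for \<open>0 < r < 1\<close>. There the terms from \<open>n = 3\<close> on contribute at most \<open>(1 - b\<^sub>2) / 3\<close>
  by the weighted bound, so \<open>b\<^sub>1 \<le> 1 + b\<^sub>2 + (1 - b\<^sub>2) / 3\<close>. These two steps are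
  \<open>inj_reciprocal_series\<close> and \<open>inj_reciprocal_b1_le\<close>.

  Inserting this bound for \<open>b\<^sub>1\<close> gives an expression convex in \<open>b\<^sub>2 \<in> [0, 1]\<close>, so the functional is at
  most the larger of its values \<open>16/9 (1 - \<gamma>)\<close> and \<open>3 - 4 \<gamma>\<close> at the end points
  (\<open>quadratic_coeff_bound\<close>). This maximum lies below each stated bound on
  its range. For \<open>\<gamma> \<le> 11/20\<close> it is
  \<open>3 - 4 \<gamma>\<close>, and \<open>1 - 2 \<gamma> \<le> exp (- 2 \<gamma> / (1 - \<gamma>))\<close> compares it with the exponential bound
  (\<open>max_le_exp_bound\<close>); for \<open>\<gamma> \<ge> 0.45\<close> already the constant \<open>5/4\<close> in place of
  \<open>(\<nu>\<^sub>0 + 1)\<^sup>2 / (2 \<nu>\<^sub>0 + 1)\<close> makes the linear bound large enough (\<open>max_le_linear_bound\<close>).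
\<close>

section \<open>The constant \<open>\<nu>\<^sub>0\<close>\<close>

text \<open>
  By \<open>1 + t < exp t\<close> for \<open>t = y - x\<close>. The equation for \<open>\<nu>\<^sub>0\<close> says that \<open>exp x / (1 + x) = 2\<close> at
  \<open>x = 2 \<nu>\<close>, so the monotonicity of this quotient gives uniqueness.
\<close>

lemma mult_exp_strict_mono:
  fixes x y :: real
  assumes "0 \<le> x" "x < y"
  shows "(1 + y) * exp x < (1 + x) * exp y"
proof -
  have "1 + y \<le> (1 + x) * (1 + (y - x))"
    using mult_nonneg_nonneg[of x "y - x"] assms by (simp add: algebra_simps)
  also have "\<dots> < (1 + x) * exp (y - x)"
    using assms exp_minus_greater[of "x - y"] by (intro mult_strict_left_mono) auto
  finally show ?thesis
    by (simp add: exp_diff field_simps)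
qed

lemma is_nu_root_iff: "is_nu_root \<nu> \<longleftrightarrow> 0 < \<nu> \<and> exp (2 * \<nu>) = 2 * (1 + 2 * \<nu>)"
  unfolding is_nu_root_def by (auto simp: exp_minus field_simps)

lemma is_nu_root_unique:
  assumes "is_nu_root \<mu>" "is_nu_root \<nu>"
  shows "\<mu> = \<nu>"
proof -
  have False if "is_nu_root x" "is_nu_root y" "x < y" for x y
    using mult_exp_strict_mono[of "2 * x" "2 * y"] that by (auto simp: is_nu_root_iff algebra_simps)
  then show ?thesis
    using assms by (metis linorder_neqE)
qed

text \<open>
  The two rational numbers below bracket \<open>\<nu>\<^sub>0\<close>. The tolerance \<open>0.0000005\<close> on \<open>\<nu>\<^sub>0 / (1 + \<nu>\<^sub>0)\<close> is nearly
  exhausted from below: it needs \<open>\<nu>\<^sub>0 > 0.83917347543\<close>, about \<open>2 / 10 ^ 8\<close> less than \<open>\<nu>\<^sub>0\<close> itself.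
  Among the fractions that are accurate enough, these have small denominators, so that the
  fifteenth Taylor partial sum remains cheap to evaluate exactly.
\<close>

lemma exp_two_mult_lower: "exp (2 * 8813 / 10502) < 2 * (1 + 2 * (8813 / 10502 :: real))"
proof -
  define x :: real where "x = 8813 / 5251"
  obtain t where t: "\<bar>t\<bar> \<le> \<bar>x\<bar>" "exp x = (\<Sum>m<15. x ^ m / fact m) + exp t / fact 15 * x ^ 15"
    using Maclaurin_exp_le by blast
  have "exp t \<le> exp (1 + 1)"
    using t(1) by (simp add: x_def)
  also have "\<dots> \<le> 3 * (3 :: real)"
    unfolding exp_add by (intro mult_mono exp_le) auto
  finally have "exp t / fact 15 * x ^ 15 \<le> 9 / fact 15 * x ^ 15"
    by (intro mult_right_mono divide_right_mono) (auto simp: x_def)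
  then have "exp x \<le> (\<Sum>m<15. x ^ m / fact m) + 9 / fact 15 * x ^ 15"
    using t(2) by simp
  also have "9 / fact 15 * x ^ 15 \<le> 2 / 10 ^ 8"
    by (simp add: x_def fact_numeral power_divide)
  also have "(\<Sum>m<15. x ^ m / fact m) + 2 / 10 ^ 8 < 2 * (1 + x)"
    by (simp add: x_def lessThan_nat_numeral fact_numeral power_divide)
  finally show ?thesis
    by (simp add: x_def)
qed

lemma exp_two_mult_upper: "2 * (1 + 2 * (407 / 485 :: real)) < exp (2 * 407 / 485)"
proof -
  define x :: real where "x = 814 / 485"
  obtain t where t: "exp x = (\<Sum>m<15. x ^ m / fact m) + exp t / fact 15 * x ^ 15"
    using Maclaurin_exp_le by blast
  have "2 * (1 + x) < (\<Sum>m<15. x ^ m / fact m)"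
    by (simp add: x_def lessThan_nat_numeral fact_numeral power_divide)
  also have "\<dots> \<le> exp x"
    using t by (simp add: x_def)
  finally show ?thesis
    by (simp add: x_def)
qed

lemma ex1_is_nu_root: "\<exists>!\<nu>. is_nu_root \<nu>"
  and nu0_lower: "8813 / 10502 \<le> nu0"
  and nu0_upper: "nu0 \<le> 407 / 485"
proof -
  define h :: "real \<Rightarrow> real" where "h = (\<lambda>\<nu>. exp (2 * \<nu>) - 2 * (1 + 2 * \<nu>))"
  have "\<exists>\<nu>\<ge>8813 / 10502. \<nu> \<le> 407 / 485 \<and> h \<nu> = 0"
    using exp_two_mult_lower exp_two_mult_upper
    by (intro IVT) (auto simp: h_def intro!: continuous_intros)
  then obtain \<nu> where \<nu>: "8813 / 10502 \<le> \<nu>" "\<nu> \<le> 407 / 485" "h \<nu> = 0"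
    by blast
  then have root: "is_nu_root \<nu>"
    by (simp add: is_nu_root_iff h_def)
  then show "\<exists>!\<nu>. is_nu_root \<nu>"
    using is_nu_root_unique by blast
  have "nu0 = \<nu>"
    unfolding nu0_def using root is_nu_root_unique by blast
  then show "8813 / 10502 \<le> nu0" "nu0 \<le> 407 / 485"
    using \<nu> by auto
qed

lemma nu0_ratio_lower: "0.4562775 \<le> nu0 / (1 + nu0)"
  and nu0_ratio_upper: "nu0 / (1 + nu0) \<le> 0.4562785"
  using nu0_lower nu0_upper by (simp_all add: pos_le_divide_eq pos_divide_le_eq)

lemma nu0_ratio_approx: "\<bar>nu0 / (1 + nu0) - 0.456278\<bar> \<le> 0.0000005"
proof -
  have "\<bar>r - 0.456278\<bar> \<le> 0.0000005" if "0.4562775 \<le> r" "r \<le> 0.4562785" for r :: real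
    using that by (auto simp: abs_if field_simps)
  then show ?thesis
    using nu0_ratio_lower nu0_ratio_upper by blast
qed

section \<open>Univalence on the real diameter\<close>

text \<open>
  The function \<open>h\<close> is strictly increasing, since it is continuous and injective
  and \<open>h x > 0 = h 0\<close> for \<open>x > 0\<close>, where \<open>x / h x\<close> is a sum of nonnegative terms. The first
  conclusion expresses that \<open>1 / h\<close> decreases on \<open>(0, 1)\<close>, the second that \<open>h\<close> is negative on
  \<open>(-1, 0)\<close>. Instead of differentiating the series, the argument takes finite differences and
  truncates them; the tail of \<open>1 / h\<close> beyond the pole has nonnegative coefficients, so dropping
  part of it keeps the inequality.
\<close>

lemma inj_reciprocal_series:
  fixes h :: "real \<Rightarrow> real" and b :: "nat \<Rightarrow> real"
  assumes cont: "continuous_on {-1<..<1} h"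
    and inj: "inj_on h {-1<..<1}"
    and h0: "h 0 = 0"
    and b0: "b 0 = 1"
    and nonneg: "\<And>n. 0 \<le> b n"
    and sums: "\<And>x. x \<noteq> 0 \<Longrightarrow> \<bar>x\<bar> < 1 \<Longrightarrow> (\<lambda>n. b n * x ^ n) sums (x / h x)"
  shows inj_reciprocal_weighted_sum_le: "(\<Sum>n=2..N. (real n - 1) * b n) \<le> 1"
    and inj_reciprocal_nonneg_at_minus: "\<And>r. 0 < r \<Longrightarrow> r < 1 \<Longrightarrow> 0 \<le> (\<Sum>n. b n * (- r) ^ n)"
proof -
  have pos: "0 < h x" if "0 < x" "x < 1" for x
  proof -
    have "b 0 * x ^ 0 \<le> x / h x"
      using sums[of x] sum_le_suminf[of "\<lambda>n. b n * x ^ n" "{0}"] that nonneg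
      by (auto simp: sums_iff)
    then have "0 < x / h x"
      using b0 by simp
    then show ?thesis
      using that by (simp add: zero_less_divide_iff)
  qed
  have mono: "(h a < h x \<and> h x < h y) \<or> (h y < h x \<and> h x < h a)"
    if "-1 < a" "a < x" "x < y" "y < 1" for a x y
    using that by (intro continuous_inj_imp_mono continuous_on_subset[OF cont] inj_on_subset[OF inj]) auto

  show "0 \<le> (\<Sum>n. b n * (- r) ^ n)" if r: "0 < r" "r < 1" for r
  proof -
    have "h (- r) < 0"
      using mono[of "- r" 0 r] pos[of r] r h0 by auto
    then show ?thesis
      using sums[of "- r"] r by (simp add: sums_iff divide_nonneg_neg)
  qed

  have diff: "(\<Sum>n=2..N. b n * (y ^ (n - 1) - x ^ (n - 1))) \<le> 1 / x - 1 / y"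
    if xy: "0 < x" "x < y" "y < 1" for x y
  proof -
    have "h x < h y"
      using mono[of 0 x y] pos[of x] xy h0 by auto
    then have "1 / h y - 1 / h x \<le> 0"
      using pos[of x] xy by (simp add: frac_le)
    have quot: "(\<lambda>n. b n * (z ^ n / z)) sums (1 / h z)" if "0 < z" "z < 1" for z
      using sums_divide[OF sums[of z], of z] that by simp
    (* the n-th term of the series for 1 / h y - 1 / h x: for n = 0 it is 1 / y - 1 / x, and
       for n = 1 it vanishes *)
    define d where "d n = b n * (y ^ n / y) - b n * (x ^ n / x)" for n
    have d_sums: "d sums (1 / h y - 1 / h x)"
      unfolding d_def using quot[of x] quot[of y] xy by (intro sums_diff) auto
    have d_Suc: "d n = b n * (y ^ (n - 1) - x ^ (n - 1))" if "n \<ge> 1" for n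
      using that xy by (cases n) (auto simp: d_def algebra_simps)
    have d_nonneg: "0 \<le> d n" if "n \<ge> 1" for n
      using that xy nonneg unfolding d_Suc[OF that]
      by (intro mult_nonneg_nonneg) (auto intro: power_mono)
    have "sum d (insert 0 {2..N}) \<le> suminf d"
    proof (rule sum_le_suminf)
      show "summable d"
        using d_sums by (simp add: sums_iff)
      show "0 \<le> d n" if "n \<in> - insert 0 {2..N}" for n
        using that by (intro d_nonneg) auto
    qed auto
    also have "suminf d \<le> 0"
      using d_sums \<open>1 / h y - 1 / h x \<le> 0\<close> by (simp add: sums_iff)
    finally have "d 0 + sum d {2..N} \<le> 0"
      by simp
    moreover have "sum d {2..N} = (\<Sum>n=2..N. b n * (y ^ (n - 1) - x ^ (n - 1)))"
      by (intro sum.cong d_Suc) auto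
    ultimately show ?thesis
      by (simp add: d_def b0)
  qed

  have diff_at_1: "(\<Sum>n=2..N. b n * (1 - x ^ (n - 1))) \<le> 1 / x - 1" if x: "0 < x" "x < 1" for x
  proof (rule tendsto_le)
    show "((\<lambda>y. \<Sum>n=2..N. b n * (y ^ (n - 1) - x ^ (n - 1))) \<longlongrightarrow>
        (\<Sum>n=2..N. b n * (1 - x ^ (n - 1)))) (at_left 1)"
      by (auto intro!: tendsto_eq_intros)
    show "((\<lambda>y. 1 / x - 1 / y) \<longlongrightarrow> 1 / x - 1) (at_left 1)"
      by (auto intro!: tendsto_eq_intros)
    show "\<forall>\<^sub>F y in at_left 1. (\<Sum>n=2..N. b n * (y ^ (n - 1) - x ^ (n - 1))) \<le> 1 / x - 1 / y"
      using eventually_at_left_real[OF x(2)] by eventually_elim (rule diff, use x in auto)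
  qed simp

  (* dividing the previous estimate by 1 - x turns each bracket into a geometric sum, which
     tends to n - 1 as x tends to 1 *)
  have "(\<Sum>n=2..N. b n * (\<Sum>k<n-1. x ^ k)) \<le> 1 / x" if x: "0 < x" "x < 1" for x
  proof -
    have "(1 - x) * (\<Sum>n=2..N. b n * (\<Sum>k<n-1. x ^ k)) =
        (\<Sum>n=2..N. (1 - x) * (b n * (\<Sum>k<n-1. x ^ k)))"
      by (rule sum_distrib_left)
    also have "\<dots> = (\<Sum>n=2..N. b n * (1 - x ^ (n - 1)))"
      by (intro sum.cong refl) (simp only: one_diff_power_eq mult_ac)
    also have "\<dots> \<le> (1 - x) * (1 / x)"
      using diff_at_1[OF x] x by (simp add: field_simps)
    finally show ?thesis
      using x by (simp only: mult_le_cancel_left_pos diff_gt_0_iff_gt)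
  qed
  then have "\<forall>\<^sub>F x in at_left 1. (\<Sum>n=2..N. b n * (\<Sum>k<n-1. x ^ k)) \<le> 1 / x"
    using eventually_at_left_real[of 0 1] by (auto elim: eventually_mono)
  moreover have "((\<lambda>x::real. \<Sum>n=2..N. b n * (\<Sum>k<n-1. x ^ k)) \<longlongrightarrow>
      (\<Sum>n=2..N. b n * (\<Sum>k<n-1. 1 ^ k))) (at_left 1)"
    by (intro tendsto_intros)
  moreover have "((\<lambda>x::real. 1 / x) \<longlongrightarrow> 1 / 1) (at_left 1)"
    by (intro tendsto_intros) auto
  ultimately have "(\<Sum>n=2..N. b n * (\<Sum>k<n-1. 1 ^ k)) \<le> 1 / 1"
    by (intro tendsto_le[of "at_left (1::real)"]) auto
  also have "(\<Sum>n=2..N. b n * (\<Sum>k<n-1. 1 ^ k)) = (\<Sum>n=2..N. (real n - 1) * b n)"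
    by (intro sum.cong) (auto simp: of_nat_diff)
  finally show "(\<Sum>n=2..N. (real n - 1) * b n) \<le> 1"
    by simp
qed

text \<open>
  At \<open>- r\<close> the odd terms from \<open>n = 3\<close> on are not positive, and the even ones have \<open>n \<ge> 4\<close>, hence
  weight \<open>n - 1 \<ge> 3\<close>. So the whole tail is at most a third of what the weighted sum leaves after
  \<open>b 2\<close>. The extreme case is \<open>b 4 = (1 - b 2) / 3\<close> with \<open>b 3\<close> and all later coefficients zero.
\<close>

lemma inj_reciprocal_b1_le:
  fixes b :: "nat \<Rightarrow> real"
  assumes b0: "b 0 = 1"
    and nonneg: "\<And>n. 0 \<le> b n"
    and weighted: "\<And>N. (\<Sum>n=2..N. (real n - 1) * b n) \<le> 1"
    and summable: "\<And>r. 0 < r \<Longrightarrow> r < 1 \<Longrightarrow> summable (\<lambda>n. b n * (- r) ^ n)"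
    and minus_nonneg: "\<And>r. 0 < r \<Longrightarrow> r < 1 \<Longrightarrow> 0 \<le> (\<Sum>n. b n * (- r) ^ n)"
  shows "b 1 \<le> 4 / 3 + 2 / 3 * b 2"
proof -
  have tail: "(- r) ^ n \<le> (real n - 1) / 3" if "0 < r" "r < 1" "3 \<le> n" for r :: real and n
  proof (cases "n = 3")
    case True
    then have "(- r) ^ n \<le> 0"
      using that by simp
    also have "0 \<le> (real n - 1) / 3"
      using that by simp
    finally show ?thesis .
  next
    case False
    have "(- r) ^ n \<le> \<bar>(- r) ^ n\<bar>"
      by (rule abs_ge_self)
    also have "\<dots> \<le> 1"
      using that by (simp add: power_abs power_le_one)
    finally show ?thesis
      using that False by auto
  qed
  have "0 \<le> 1 - b 1 * r + b 2 * r ^ 2 + (1 - b 2) / 3" if r: "0 < r" "r < 1" for r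
  proof -
    define s where "s n = b n * (- r) ^ n" for n
    have "summable s"
      unfolding s_def using summable r by simp
    have partial: "sum s {..<N + 3} \<le> 1 - b 1 * r + b 2 * r ^ 2 + (1 - b 2) / 3" for N
    proof -
      have "sum s {..<N + 3} = s 0 + s 1 + s 2 + (\<Sum>n=3..<N+3. s n)"
      proof -
        have "sum s {..<N + 3} = sum s {..<3} + (\<Sum>n=3..<N+3. s n)"
          by (subst sum.union_disjoint[symmetric]) (auto intro!: sum.cong)
        then show ?thesis
          by (simp add: eval_nat_numeral)
      qed
      also have "(\<Sum>n=3..<N+3. s n) \<le> (\<Sum>n=3..<N+3. b n * ((real n - 1) / 3))"
        unfolding s_def using tail r nonneg by (intro sum_mono mult_left_mono) auto
      also have "\<dots> = (\<Sum>n=3..N+2. (real n - 1) * b n) / 3"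
        unfolding sum_divide_distrib by (intro sum.cong) auto
      also have "(\<Sum>n=3..N+2. (real n - 1) * b n) = (\<Sum>n=2..N+2. (real n - 1) * b n) - b 2"
        using sum.atLeast_Suc_atMost[of 2 "N + 2" "\<lambda>n. (real n - 1) * b n"]
        by (simp del: sum.cl_ivl_Suc)
      also have "\<dots> \<le> 1 - b 2"
        using weighted[of "N + 2"] by simp
      finally show ?thesis
        by (simp add: s_def b0 power2_eq_square)
    qed
    have "(\<lambda>N. sum s {..<N + 3}) \<longlonglongrightarrow> suminf s"
      using summable_LIMSEQ[OF \<open>summable s\<close>] by (rule LIMSEQ_ignore_initial_segment)
    then have "suminf s \<le> 1 - b 1 * r + b 2 * r ^ 2 + (1 - b 2) / 3"
      by (rule LIMSEQ_le_const2) (use partial in auto)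
    moreover have "0 \<le> suminf s"
      unfolding s_def using minus_nonneg r by simp
    ultimately show ?thesis
      by simp
  qed
  then have "\<forall>\<^sub>F r in at_left 1. 0 \<le> 1 - b 1 * r + b 2 * r ^ 2 + (1 - b 2) / 3"
    using eventually_at_left_real[of 0 1] by (auto elim: eventually_mono)
  moreover have "((\<lambda>r. 1 - b 1 * r + b 2 * r ^ 2 + (1 - b 2) / 3) \<longlongrightarrow>
      1 - b 1 * 1 + b 2 * 1 ^ 2 + (1 - b 2) / 3) (at_left 1)"
    by (intro tendsto_intros)
  ultimately have "0 \<le> 1 - b 1 * 1 + b 2 * 1 ^ 2 + (1 - b 2) / 3"
    by (intro tendsto_lowerbound[of _ _ "at_left (1::real)"]) auto
  then show ?thesis
    by (simp add: field_simps)
qed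

section \<open>The coefficients of a function in the class\<close>

lemma taylor_coeffs_of_reciprocal_expansion:
  assumes f: "f analytic_on {0}"
    and g: "g has_fps_expansion G" "fps_nth G 0 = 1"
    and prod: "\<forall>\<^sub>F z in nhds 0. f z * g z = z"
  shows "taylor_coeff f 0 = 0" "taylor_coeff f 1 = 1" "taylor_coeff f 2 = - fps_nth G 1"
    "taylor_coeff f 3 = (fps_nth G 1)\<^sup>2 - fps_nth G 2"
proof -
  define F where "F = fps_expansion f 0"
  have "(\<lambda>z. f z * g z) has_fps_expansion F * G"
    unfolding F_def using f g
    by (intro has_fps_expansion_mult analytic_at_imp_has_fps_expansion_0)
  then have "(\<lambda>z. z) has_fps_expansion F * G"
    using prod by (simp add: has_fps_expansion_cong)
  then have FG: "F * G = fps_X"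
    using fps_expansion_unique_complex has_fps_expansion_fps_X by blast
  have "fps_nth (F * G) n = (if n = 1 then 1 else 0)" for n
    by (simp add: FG fps_X_def)
  from this[of 0] this[of 1] this[of 2] this[of 3]
  have F: "fps_nth F 0 = 0" "fps_nth F 1 = 1" "fps_nth F 2 + fps_nth G 1 = 0"
    "fps_nth F 3 + fps_nth F 2 * fps_nth G 1 + fps_nth G 2 = 0"
    by (simp_all add: fps_mult_nth g(2) eval_nat_numeral sum.atLeast_Suc_atMost algebra_simps)
  then have "fps_nth F 2 = - fps_nth G 1"
    by (simp add: eq_neg_iff_add_eq_0)
  with F(4) have "fps_nth F 3 = (fps_nth G 1)\<^sup>2 - fps_nth G 2"
    by (simp add: power2_eq_square algebra_simps)
  with F \<open>fps_nth F 2 = - fps_nth G 1\<close> show "taylor_coeff f 0 = 0" "taylor_coeff f 1 = 1"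
    "taylor_coeff f 2 = - fps_nth G 1" "taylor_coeff f 3 = (fps_nth G 1)\<^sup>2 - fps_nth G 2"
    by (simp_all add: taylor_coeff_def F_def)
qed

text \<open>
  The estimates on the real diameter apply to the real part of \<open>f\<close> there: the expansion of
  \<open>z / f z\<close> has real coefficients, so \<open>f\<close> is real on \<open>(-1, 1)\<close>, and the real part inherits
  injectivity.
\<close>

lemma class_S_plus_coeffs:
  assumes "f \<in> class_S_plus"
  obtains b1 b2 :: real where "0 \<le> b1" "0 \<le> b2" "b2 \<le> 1" "b1 \<le> 4 / 3 + 2 / 3 * b2"
    "taylor_coeff f 2 = - of_real b1" "taylor_coeff f 3 = of_real (b1\<^sup>2 - b2)"
proof -
  obtain b :: "nat \<Rightarrow> real" where b0: "b 0 = 1" and "\<And>n. n \<ge> 1 \<Longrightarrow> 0 \<le> b n"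
    and sums: "\<And>z. z \<in> \<D> - {0} \<Longrightarrow> (\<lambda>n. of_real (b n) * z ^ n) sums (z / f z)"
    using assms unfolding class_S_plus_def by blast
  then have nonneg: "0 \<le> b n" for n
    by (cases n) auto
  have ana: "f analytic_on \<D>" and inj: "inj_on f \<D>" and "taylor_coeff f 0 = 0"
    using assms unfolding class_S_plus_def class_A_def by auto
  have ana0: "f analytic_on {0}"
    using ana by (rule analytic_on_subset) auto
  have f0: "f 0 = 0"
    using has_fps_expansion_imp_0_eq_fps_nth_0[OF analytic_at_imp_has_fps_expansion_0[OF ana0]]
      \<open>taylor_coeff f 0 = 0\<close> by (simp add: taylor_coeff_def)
  have fnz: "f z \<noteq> 0" if "z \<in> \<D>" "z \<noteq> 0" for z
    using inj_onD[OF inj, of z 0] f0 that by auto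

  define h where "h x = Re (f (of_real x))" for x
  have f_real: "f (of_real x) = of_real (h x)" if "\<bar>x\<bar> < 1" for x
  proof (cases "x = 0")
    case False
    have "(\<lambda>n. of_real (b n * x ^ n)) sums (of_real x / f (of_real x))"
      using sums[of "of_real x"] that False by simp
    then have "(\<lambda>n. Im (of_real (b n * x ^ n))) sums Im (of_real x / f (of_real x))"
      by (rule sums_Im)
    then have "Im (of_real x / f (of_real x)) = 0"
      using sums_unique2[OF sums_zero] by simp
    then have "of_real x / f (of_real x) \<in> \<real>"
      by (simp add: complex_is_Real_iff)
    then have "of_real x / (of_real x / f (of_real x)) \<in> \<real>"
      by (rule Reals_divide[OF Reals_of_real])
    then have "f (of_real x) \<in> \<real>"
      using False by simp
    then show ?thesis
      by (simp add: h_def of_real_Re)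
  qed (simp add: h_def f0)
  have cont: "continuous_on {-1<..<1} h"
  proof -
    have "continuous_on \<D> f"
      using ana by (intro holomorphic_on_imp_continuous_on analytic_imp_holomorphic)
    then have "continuous_on {-1<..<1} (\<lambda>x::real. f (of_real x))"
      by (rule continuous_on_compose2) (auto intro!: continuous_intros)
    then show ?thesis
      unfolding h_def by (intro continuous_intros)
  qed
  have inj_h: "inj_on h {-1<..<1}"
  proof (rule inj_onI)
    fix x y assume xy: "x \<in> {-1<..<1}" "y \<in> {-1<..<1}" "h x = h y"
    then have "f (of_real x) = f (of_real y)" "of_real x \<in> \<D>" "of_real y \<in> \<D>"
      using f_real[of x] f_real[of y] by auto
    then have "complex_of_real x = of_real y"
      by (rule inj_onD[OF inj])
    then show "x = y"
      by simp
  qed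
  have h_sums: "(\<lambda>n. b n * x ^ n) sums (x / h x)" if "x \<noteq> 0" "\<bar>x\<bar> < 1" for x
  proof -
    have "(\<lambda>n. complex_of_real (b n * x ^ n)) sums of_real (x / h x)"
      using sums[of "of_real x"] f_real[of x] that by simp
    then show ?thesis
      by (simp only: sums_of_real_iff)
  qed
  have h0: "h 0 = 0"
    by (simp add: h_def f0)
  note bounds = inj_reciprocal_series[OF cont inj_h h0 b0 nonneg h_sums]
  have "summable (\<lambda>n. b n * (- r) ^ n)" if "0 < r" "r < 1" for r
    using h_sums[of "- r"] that by (auto simp: sums_iff)
  then have b1: "b 1 \<le> 4 / 3 + 2 / 3 * b 2"
    using b0 nonneg bounds by (intro inj_reciprocal_b1_le) auto
  have b2: "b 2 \<le> 1"
    using bounds(1)[of 2] by simp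

  define G where "G = Abs_fps (\<lambda>n. complex_of_real (b n))"
  (* z / f z with the removable singularity at 0 filled in *)
  define g where "g z = (if z = 0 then 1 else z / f z)" for z
  have near: "\<forall>\<^sub>F z in nhds (0::complex). z \<in> \<D>"
    by (intro eventually_nhds_in_open) auto
  have "\<forall>\<^sub>F z in nhds 0. (\<lambda>n. fps_nth G n * z ^ n) sums g z"
    using near
  proof eventually_elim
    case (elim z)
    then show ?case
      using sums[of z] powser_sums_zero[of "\<lambda>n. complex_of_real (b n)"] b0
      by (cases "z = 0") (auto simp: g_def G_def)
  qed
  then have "g has_fps_expansion G"
    by (rule has_fps_expansionI)
  moreover have "\<forall>\<^sub>F z in nhds 0. f z * g z = z"
    using near by eventually_elim (auto simp: g_def f0 fnz)
  moreover have "fps_nth G 0 = 1"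
    by (simp add: G_def b0)
  ultimately have "taylor_coeff f 2 = - of_real (b 1)" "taylor_coeff f 3 = of_real ((b 1)\<^sup>2 - b 2)"
    using taylor_coeffs_of_reciprocal_expansion[OF ana0, of g G] by (simp_all add: G_def)
  then show ?thesis
    using that nonneg b1 b2 by blast
qed

section \<open>The extremal problem for two coefficients\<close>

text \<open>
  Equality holds at \<open>\<nu> = 0\<close>, and the difference of the two sides has derivative
  \<open>1 - (1 + 2 \<nu>) exp (- 2 \<nu>)\<close>, which is nonnegative by \<open>1 + 2 \<nu> \<le> exp (2 \<nu>)\<close>.
\<close>

lemma one_minus_le_one_plus_mult_exp:
  fixes \<nu> :: real
  assumes "0 \<le> \<nu>"
  shows "1 - \<nu> \<le> (1 + \<nu>) * exp (- 2 * \<nu>)"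
proof -
  define \<phi> :: "real \<Rightarrow> real" where "\<phi> = (\<lambda>x. (1 + x) * exp (- 2 * x) + x)"
  have "\<phi> 0 \<le> \<phi> \<nu>"
  proof (rule DERIV_nonneg_imp_nondecreasing[OF assms])
    fix x :: real
    assume "0 \<le> x" "x \<le> \<nu>"
    have "(\<phi> has_real_derivative 1 - (1 + 2 * x) * exp (- 2 * x)) (at x)"
      unfolding \<phi>_def by (auto intro!: derivative_eq_intros simp: algebra_simps)
    moreover have "(1 + 2 * x) * exp (- 2 * x) \<le> exp (2 * x) * exp (- 2 * x)"
      by (intro mult_right_mono) auto
    then have "0 \<le> 1 - (1 + 2 * x) * exp (- 2 * x)"
      by (simp add: exp_minus)
    ultimately show "\<exists>y. (\<phi> has_real_derivative y) (at x) \<and> 0 \<le> y"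
      by blast
  qed
  then show ?thesis
    by (simp add: \<phi>_def)
qed

text \<open>The previous estimate under the substitution \<open>\<nu> = \<gamma> / (1 - \<gamma>)\<close>, for which \<open>1 + \<nu> = 1 / (1 - \<gamma>)\<close>.\<close>

lemma one_minus_double_le_exp:
  fixes \<gamma> :: real
  assumes "0 \<le> \<gamma>" "\<gamma> < 1"
  shows "1 - 2 * \<gamma> \<le> exp (- 2 * \<gamma> / (1 - \<gamma>))"
proof -
  have "1 - \<gamma> / (1 - \<gamma>) \<le> (1 + \<gamma> / (1 - \<gamma>)) * exp (- 2 * (\<gamma> / (1 - \<gamma>)))"
    using assms by (intro one_minus_le_one_plus_mult_exp) auto
  moreover have "1 - \<gamma> / (1 - \<gamma>) = (1 - 2 * \<gamma>) / (1 - \<gamma>)" "1 + \<gamma> / (1 - \<gamma>) = 1 / (1 - \<gamma>)"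
    using assms by (simp_all add: field_simps)
  ultimately have "(1 - 2 * \<gamma>) / (1 - \<gamma>) \<le> exp (- 2 * \<gamma> / (1 - \<gamma>)) / (1 - \<gamma>)"
    by simp
  then show ?thesis
    using assms by (simp add: divide_le_cancel)
qed

text \<open>
  The square \<open>(4/3 + 2/3 b2)\<^sup>2\<close> is convex in \<open>b2\<close> and so lies below its chord
  \<open>16/9 + 20/9 b2\<close> over \<open>[0, 1]\<close>. The resulting bound is affine in \<open>b2\<close>, with the value
  \<open>16/9 (1 - \<gamma>)\<close> at \<open>0\<close> and \<open>3 - 4 \<gamma>\<close> at \<open>1\<close>.
\<close>

lemma quadratic_coeff_bound:
  fixes \<gamma> b1 b2 :: real
  assumes "\<gamma> \<le> 1" "0 \<le> b1" "0 \<le> b2" "b2 \<le> 1" "b1 \<le> 4 / 3 + 2 / 3 * b2"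
  shows "(1 - \<gamma>) * b1\<^sup>2 - b2 \<le> max (3 - 4 * \<gamma>) (16 / 9 * (1 - \<gamma>))"
proof -
  have "b1\<^sup>2 \<le> (4 / 3 + 2 / 3 * b2)\<^sup>2"
    using assms by (intro power_mono) auto
  also have "\<dots> \<le> 16 / 9 + 20 / 9 * b2"
    using mult_left_mono[of b2 1 b2] assms by (simp add: power2_eq_square field_simps)
  finally have "(1 - \<gamma>) * b1\<^sup>2 \<le> (1 - \<gamma>) * (16 / 9 + 20 / 9 * b2)"
    using assms by (intro mult_left_mono) auto
  then have "(1 - \<gamma>) * b1\<^sup>2 - b2 \<le> b2 * (3 - 4 * \<gamma>) + (1 - b2) * (16 / 9 * (1 - \<gamma>))"
    by (simp add: field_simps)
  also have "\<dots> \<le> max (3 - 4 * \<gamma>) (16 / 9 * (1 - \<gamma>))"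
    using assms by (intro convex_bound_le) auto
  finally show ?thesis .
qed

lemma max_le_exp_bound:
  assumes "0 \<le> \<gamma>" "\<gamma> \<le> nu0 / (1 + nu0)"
  shows "max (3 - 4 * \<gamma>) (16 / 9 * (1 - \<gamma>)) \<le> 1 + 2 * exp (- 2 * \<gamma> / (1 - \<gamma>))"
proof -
  have "\<gamma> \<le> 0.4562785"
    using assms(2) nu0_ratio_upper by (rule order_trans)
  then have "16 / 9 * (1 - \<gamma>) \<le> 3 - 4 * \<gamma>" "1 - 2 * \<gamma> \<le> exp (- 2 * \<gamma> / (1 - \<gamma>))"
    using assms one_minus_double_le_exp[of \<gamma>] by auto
  then show ?thesis
    by linarith
qed

lemma max_le_linear_bound:
  assumes "nu0 / (1 + nu0) \<le> \<gamma>" "\<gamma> < 1"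
  shows "max (3 - 4 * \<gamma>) (16 / 9 * (1 - \<gamma>)) \<le> 2 * (1 - \<gamma>) * ((nu0 + 1)\<^sup>2 / (2 * nu0 + 1))"
proof -
  (* (nu0 + 1)^2 / (2 * nu0 + 1) = 1 + nu0^2 / (2 * nu0 + 1), where nu0^2 > 0.68 *)
  have "0.83 * 0.83 \<le> nu0 * nu0"
    using nu0_lower by (intro mult_mono) auto
  then have "5 / 4 \<le> (nu0 + 1)\<^sup>2 / (2 * nu0 + 1)"
    using nu0_lower nu0_upper by (simp add: field_simps power2_eq_square)
  then have "2 * (1 - \<gamma>) * (5 / 4) \<le> 2 * (1 - \<gamma>) * ((nu0 + 1)\<^sup>2 / (2 * nu0 + 1))"
    using assms by (intro mult_left_mono) auto
  moreover have "0.4562775 \<le> \<gamma>"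
    using nu0_ratio_lower assms(1) by (rule order_trans)
  ultimately show ?thesis
    using assms by auto
qed

lemma fekete_szego_class_S_plus:
  assumes f: "f \<in> class_S_plus" and \<gamma>: "0 \<le> \<gamma>" "\<gamma> < 1"
  shows "fekete_szego \<gamma> f \<in> \<real>" "- 1 \<le> Re (fekete_szego \<gamma> f)"
    "Re (fekete_szego \<gamma> f) \<le> max (3 - 4 * \<gamma>) (16 / 9 * (1 - \<gamma>))"
proof -
  obtain b1 b2 :: real where b: "0 \<le> b1" "0 \<le> b2" "b2 \<le> 1" "b1 \<le> 4 / 3 + 2 / 3 * b2"
    and coeffs: "taylor_coeff f 2 = - of_real b1" "taylor_coeff f 3 = of_real (b1\<^sup>2 - b2)"
    by (rule class_S_plus_coeffs[OF f])
  have eq: "fekete_szego \<gamma> f = of_real ((1 - \<gamma>) * b1\<^sup>2 - b2)"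
    by (simp add: fekete_szego_def coeffs algebra_simps)
  then show "fekete_szego \<gamma> f \<in> \<real>"
    by (metis Reals_of_real)
  have "0 \<le> (1 - \<gamma>) * b1\<^sup>2"
    using \<gamma> by simp
  with b show "- 1 \<le> Re (fekete_szego \<gamma> f)"
    by (simp only: eq Re_complex_of_real)
  show "Re (fekete_szego \<gamma> f) \<le> max (3 - 4 * \<gamma>) (16 / 9 * (1 - \<gamma>))"
    using quadratic_coeff_bound[of \<gamma>] b \<gamma> by (simp only: eq Re_complex_of_real)
qed

section \<open>Sharpness of the lower bound\<close>

lemma one_plus_square_neq_0:
  fixes z :: complex
  assumes "z \<in> \<D>"
  shows "1 + z\<^sup>2 \<noteq> 0"
proof
  assume "1 + z\<^sup>2 = 0"
  then have "z\<^sup>2 = - 1"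
    by (simp add: eq_neg_iff_add_eq_0 add.commute)
  then have "norm z ^ 2 = 1"
    by (metis norm_minus_cancel norm_one norm_power)
  then show False
    using assms norm_ge_zero[of z] by (auto simp: power2_eq_1_iff)
qed

lemma extremal_analytic: "(\<lambda>z::complex. z / (1 + z\<^sup>2)) analytic_on \<D>"
  by (intro analytic_intros one_plus_square_neq_0)

lemma extremal_taylor_coeffs:
  fixes f :: "complex \<Rightarrow> complex"
  defines "f \<equiv> (\<lambda>z. z / (1 + z\<^sup>2))"
  shows "taylor_coeff f 0 = 0" "taylor_coeff f 1 = 1" "taylor_coeff f 2 = 0" "taylor_coeff f 3 = - 1"
proof -
  have "f analytic_on {0}"
    unfolding f_def by (rule analytic_on_subset[OF extremal_analytic]) auto
  moreover have "(\<lambda>z::complex. 1 + z\<^sup>2) has_fps_expansion 1 + fps_X ^ 2"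
    by (intro fps_expansion_intros)
  moreover have "\<forall>\<^sub>F z in nhds (0::complex). z \<in> \<D>"
    by (intro eventually_nhds_in_open) auto
  then have "\<forall>\<^sub>F z in nhds 0. f z * (1 + z\<^sup>2) = z"
    by eventually_elim (auto simp: f_def one_plus_square_neq_0)
  ultimately show "taylor_coeff f 0 = 0" "taylor_coeff f 1 = 1" "taylor_coeff f 2 = 0"
    "taylor_coeff f 3 = - 1"
    using taylor_coeffs_of_reciprocal_expansion[of f "\<lambda>z. 1 + z\<^sup>2" "1 + fps_X ^ 2"]
    by (simp_all add: fps_X_power_nth)
qed

lemma extremal_inj: "inj_on (\<lambda>z::complex. z / (1 + z\<^sup>2)) \<D>"
proof (rule inj_onI)
  fix z w :: complex
  assume zw: "z \<in> \<D>" "w \<in> \<D>" "z / (1 + z\<^sup>2) = w / (1 + w\<^sup>2)"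
  then have "z * (1 + w\<^sup>2) = w * (1 + z\<^sup>2)"
    using one_plus_square_neq_0 by (simp add: frac_eq_eq)
  then have "(z - w) * (1 - z * w) = 0"
    by (simp add: algebra_simps power2_eq_square)
  moreover have "norm (z * w) < 1"
    using mult_strict_mono'[of "norm z" 1 "norm w" 1] zw by (simp add: norm_mult)
  then have "z * w \<noteq> 1"
    by auto
  ultimately show "z = w"
    by simp
qed

lemma extremal_in_class_S_plus: "(\<lambda>z::complex. z / (1 + z\<^sup>2)) \<in> class_S_plus"
proof -
  define b :: "nat \<Rightarrow> real" where "b n = (if n = 0 \<or> n = 2 then 1 else 0)" for n
  have "(\<lambda>n. of_real (b n) * z ^ n) sums (z / (z / (1 + z\<^sup>2)))" if "z \<in> \<D> - {0}" for z :: complex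
  proof -
    have "(\<lambda>n. of_real (b n) * z ^ n) sums (\<Sum>n\<in>{0, 2}. of_real (b n) * z ^ n)"
      by (rule sums_finite) (auto simp: b_def)
    then show ?thesis
      using that by (simp add: b_def)
  qed
  moreover have "b 0 = 1" "\<forall>n\<ge>1. 0 \<le> b n"
    by (auto simp: b_def)
  ultimately show ?thesis
    using extremal_analytic extremal_inj extremal_taylor_coeffs
    unfolding class_S_plus_def class_A_def by blast
qed

section \<open>The coefficient inequality\<close>

theorem theorem1:
  shows "(\<exists>!\<nu>. is_nu_root \<nu>) \<and>
    0.83917 \<le> nu0 \<and> nu0 < 0.83918 \<and>
    \<bar>nu0 / (1 + nu0) - 0.456278\<bar> \<le> 0.0000005 \<and>
    (\<forall>f \<in> class_S_plus. \<forall>\<gamma>::real. 0 \<le> \<gamma> \<and> \<gamma> < 1 \<longrightarrow>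
      fekete_szego \<gamma> f \<in> \<real> \<and>
      - 1 \<le> Re (fekete_szego \<gamma> f) \<and>
      (\<gamma> \<le> nu0 / (1 + nu0) \<longrightarrow>
        Re (fekete_szego \<gamma> f) \<le> 1 + 2 * exp (- 2 * \<gamma> / (1 - \<gamma>))) \<and>
      (nu0 / (1 + nu0) \<le> \<gamma> \<longrightarrow>
        Re (fekete_szego \<gamma> f) \<le> 2 * (1 - \<gamma>) * ((nu0 + 1)\<^sup>2 / (2 * nu0 + 1)))) \<and>
    (\<lambda>z. z / (1 + z\<^sup>2)) \<in> class_S_plus \<and>
    (\<forall>\<gamma>::real. 0 \<le> \<gamma> \<and> \<gamma> < 1 \<longrightarrow> fekete_szego \<gamma> (\<lambda>z. z / (1 + z\<^sup>2)) = - 1)"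
proof (intro conjI ballI allI impI; (elim conjE)?)
  show "\<exists>!\<nu>. is_nu_root \<nu>"
    by (rule ex1_is_nu_root)
  show "0.83917 \<le> nu0" "nu0 < 0.83918"
    using nu0_lower nu0_upper by auto
  show "\<bar>nu0 / (1 + nu0) - 0.456278\<bar> \<le> 0.0000005"
    by (rule nu0_ratio_approx)
  fix f \<gamma> assume f: "f \<in> class_S_plus" and \<gamma>: "0 \<le> \<gamma>" "\<gamma> < (1::real)"
  note bounds = fekete_szego_class_S_plus[OF f \<gamma>]
  show "fekete_szego \<gamma> f \<in> \<real>" "- 1 \<le> Re (fekete_szego \<gamma> f)"
    by (fact bounds)+
  show "Re (fekete_szego \<gamma> f) \<le> 1 + 2 * exp (- 2 * \<gamma> / (1 - \<gamma>))" if "\<gamma> \<le> nu0 / (1 + nu0)"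
    using bounds(3) max_le_exp_bound[OF \<gamma>(1) that] by linarith
  show "Re (fekete_szego \<gamma> f) \<le> 2 * (1 - \<gamma>) * ((nu0 + 1)\<^sup>2 / (2 * nu0 + 1))"
    if "nu0 / (1 + nu0) \<le> \<gamma>"
    using bounds(3) max_le_linear_bound[OF that \<gamma>(2)] by linarith
next
  show "(\<lambda>z. z / (1 + z\<^sup>2)) \<in> class_S_plus"
    by (rule extremal_in_class_S_plus)
  fix \<gamma> :: real
  show "fekete_szego \<gamma> (\<lambda>z. z / (1 + z\<^sup>2)) = - 1"
    by (simp add: fekete_szego_def extremal_taylor_coeffs)
qed

end
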